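(* Let $K$ be a number field of degree $n=s+2t$ over $\mathbb{Q}$, $t>0$, with exactly $s\geq1$ real embeddings and exactly $2t$ complex (non-real) embeddings, let $M_K=(\mathbb{H}^s\times\mathbb{C}^t)/\Gamma$ be an associated Oeljeklaus-Toma manifold, and let $\pi:\mathbb{H}^s\times\mathbb{C}^t\to M_K$ be the quotient map. Let $\Sigma\subset TM_K$ be the holomorphic foliation on $M_K$ whose pullback to $\mathbb{H}^s\times\mathbb{C}^t$ is generated by $\frac{\partial}{\partial z_{s+1}},\dots,\frac{\partial}{\partial z_{s+t}}$. Consider a leaf of $\Sigma$, and let $Z\subset M_K$ be its closure. Then: (i) The preimage $\pi^{-1}(Z)\subset\mathbb{H}^s\times\mathbb{C}^t$ contains the set $$Z_{\alpha_1,\dots,\alpha_s}:=\{(z_1,\dots,z_s,z_{s+1},\dots,z_{s+t})\in\mathbb{H}^s\times\mathbb{C}^t \mid \operatorname{Im} z_i=\alpha_i,\ i=1,\dots,s\}$$ for some positive real numbers $\alpha_1,\dots,\alpha_s$. (ii) Any closed complex analytic subvariety of $M_K$ containing $Z$ must coincide with $M_K$.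
   Context: Let $\sigma_1,\dots,\sigma_s:K\to\mathbb{R}\subset\mathbb{C}$ be the real embeddings of $K$ and $\sigma_{s+1},\dots,\sigma_{s+2t}$ the non-real ones, ordered so that $\sigma_{s+t+j}=\overline{\sigma_{s+j}}$ for $j=1,\dots,t$. Let $\mathcal{O}_K$ be the ring of integers, $\mathcal{O}_K^*$ its group of units, $\mathcal{O}_K^{*,+}$ the group of units $u$ with $\sigma_i(u)>0$ for $i=1,\dots,s$, and $\mathbb{H}\subset\mathbb{C}$ the upper half-plane. The group $\mathcal{O}_K\rtimes\mathcal{O}_K^{*,+}$ acts freely on $\mathbb{H}^s\times\mathbb{C}^t$ (coordinates $z_1,\dots,z_{s+t}$) by $T_a(z_i)=(z_i+\sigma_i(a))$, $a\in\mathcal{O}_K$, and $R_u(z_i)=(\sigma_i(u)z_i)$, $u\in\mathcal{O}_K^{*,+}$, $i=1,\dots,s+t$. Let $U\subset\mathcal{O}_K^{*,+}$ be an admissible subgroup, i.e. a subgroup of rank $s$ such that $\{(\log\sigma_1(u),\dots,\log\sigma_s(u)): u\in U\}$ is a full lattice in $\mathbb{R}^s$; then $\Gamma:=\mathcal{O}_K\rtimes U$ acts freely, properly discontinuously and cocompactly, and $M_K=(\mathbb{H}^s\times\mathbb{C}^t)/\Gamma$ is a compact complex manifold of dimension $s+t$, called an Oeljeklaus-Toma manifold. The foliation on $\mathbb{H}^s\times\mathbb{C}^t$ generated by $\frac{\partial}{\partial z_{s+1}},\dots,\frac{\partial}{\partial z_{s+t}}$ is $\Gamma$-invariant, so it descends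 to the foliation $\Sigma$ on $M_K$. The closure of the leaf is taken in the usual (Euclidean) topology. *)

theory Defs
  imports "HOL-Analysis.Analysis" "HOL-Computational_Algebra.Computational_Algebra"
begin

section \<open>Number fields and their embeddings\<close>

text \<open>The field $K$ is a type \<open>'k\<close> of class \<^class>\<open>field_char_0\<close>, regarded as a vector space
  over its prime field.\<close>

definition rat_scale :: "rat \<Rightarrow> 'k \<Rightarrow> 'k::field_char_0" where
  "rat_scale r x = of_rat r * x"

interpretation rat: vector_space "rat_scale :: rat \<Rightarrow> 'k \<Rightarrow> 'k::field_char_0"
  by unfold_locales (simp_all add: rat_scale_def algebra_simps of_rat_add of_rat_mult)

definition number_field :: "'k::field_char_0 itself \<Rightarrow> bool" where
  "number_field _ \<longleftrightarrow> (\<exists>B :: 'k set. finite B \<and> rat.span B = UNIV)"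

definition field_degree :: "'k::field_char_0 itself \<Rightarrow> nat" where
  "field_degree _ = rat.dim (UNIV :: 'k set)"

definition complex_embeddings :: "('k::field_char_0 \<Rightarrow> complex) set" where
  "complex_embeddings = {f. f 1 = 1 \<and> (\<forall>x y. f (x + y) = f x + f y) \<and> (\<forall>x y. f (x * y) = f x * f y)}"

definition real_embeddings :: "('k::field_char_0 \<Rightarrow> complex) set" where
  "real_embeddings = {f \<in> complex_embeddings. range f \<subseteq> \<real>}"

definition nonreal_embeddings :: "('k::field_char_0 \<Rightarrow> complex) set" where
  "nonreal_embeddings = complex_embeddings - real_embeddings"

text \<open>With $s$ = \<open>CARD('s)\<close> and $t$ = \<open>CARD('t)\<close>, the index type \<open>'s + 't\<close> stands for
  $\{1,\dots,s+t\}$: \<open>Inl\<close> gives the indices $1,\dots,s$ and \<open>Inr\<close> the indices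
  $s+1,\dots,s+t$. The remaining embeddings $\sigma_{s+t+j}=\overline{\sigma_{s+j}}$ are not
  given a name of their own; the second condition says that
  $\sigma_{s+1},\dots,\sigma_{s+2t}$ lists every non-real embedding exactly once. Since types are
  inhabited, $s\ge 1$ and $t\ge 1$ are automatic.\<close>

definition embedding_numbering :: "('s::finite + 't::finite \<Rightarrow> 'k::field_char_0 \<Rightarrow> complex) \<Rightarrow> bool" where
  "embedding_numbering \<sigma> \<longleftrightarrow>
     bij_betw (\<lambda>i. \<sigma> (Inl i)) UNIV real_embeddings \<and>
     bij_betw (case_sum (\<lambda>j. \<sigma> (Inr j)) (\<lambda>j x. cnj (\<sigma> (Inr j) x))) (UNIV :: ('t + 't) set)
       nonreal_embeddings"

section \<open>Integers, units and admissible subgroups\<close>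

definition int_ring :: "'k::field_char_0 set" where
  "int_ring = {x. algebraic_int x}"

definition int_units :: "'k::field_char_0 set" where
  "int_units = {u. u \<noteq> 0 \<and> u \<in> int_ring \<and> inverse u \<in> int_ring}"

text \<open>\<open>\<sigma> (Inl i)\<close> is a real embedding, so its value is recovered by \<^const>\<open>Re\<close>.\<close>

definition pos_units :: "('s::finite + 't::finite \<Rightarrow> 'k::field_char_0 \<Rightarrow> complex) \<Rightarrow> 'k set" where
  "pos_units \<sigma> = {u \<in> int_units. \<forall>i. Re (\<sigma> (Inl i) u) > 0}"

definition mult_subgroup :: "'k::field set \<Rightarrow> bool" where
  "mult_subgroup U \<longleftrightarrow> 0 \<notin> U \<and> 1 \<in> U \<and> (\<forall>u\<in>U. \<forall>v\<in>U. u * v \<in> U) \<and> (\<forall>u\<in>U. inverse u \<in> U)"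

definition mult_independent :: "'k::field set \<Rightarrow> bool" where
  "mult_independent B \<longleftrightarrow>
     (\<forall>S e. finite S \<and> S \<subseteq> B \<and> (\<Prod>b\<in>S. b powi e b) = 1 \<longrightarrow> (\<forall>b\<in>S. e b = 0))"

definition mult_rank_eq :: "'k::field set \<Rightarrow> nat \<Rightarrow> bool" where
  "mult_rank_eq U r \<longleftrightarrow>
     (\<exists>B\<subseteq>U. finite B \<and> card B = r \<and> mult_independent B) \<and>
     (\<forall>B\<subseteq>U. mult_independent B \<longrightarrow> finite B \<and> card B \<le> r)"

definition log_embedding ::
    "('s::finite + 't::finite \<Rightarrow> 'k::field_char_0 \<Rightarrow> complex) \<Rightarrow> 'k \<Rightarrow> real ^ 's" where
  "log_embedding \<sigma> u = (\<chi> i. ln (Re (\<sigma> (Inl i) u)))"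

definition full_lattice :: "(real ^ 's::finite) set \<Rightarrow> bool" where
  "full_lattice \<Lambda> \<longleftrightarrow>
     (\<exists>b :: 's \<Rightarrow> real ^ 's. inj b \<and> independent (range b) \<and>
        \<Lambda> = {\<Sum>i\<in>UNIV. of_int (c i) *\<^sub>R b i | c :: 's \<Rightarrow> int. True})"

definition admissible ::
    "('s::finite + 't::finite \<Rightarrow> 'k::field_char_0 \<Rightarrow> complex) \<Rightarrow> 'k set \<Rightarrow> bool" where
  "admissible \<sigma> U \<longleftrightarrow>
     U \<subseteq> pos_units \<sigma> \<and> mult_subgroup U \<and> mult_rank_eq U CARD('s) \<and>
     full_lattice (log_embedding \<sigma> ` U)"

section \<open>Oeljeklaus--Toma manifolds\<close>

text \<open>$\mathbb{H}^s\times\mathbb{C}^t$\<close>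

definition HC :: "(complex ^ ('s::finite + 't::finite)) set" where
  "HC = {z. \<forall>i. Im (z $ Inl i) > 0}"

definition OT_T :: "('s::finite + 't::finite \<Rightarrow> 'k \<Rightarrow> complex) \<Rightarrow> 'k
    \<Rightarrow> complex ^ ('s + 't) \<Rightarrow> complex ^ ('s + 't)" where
  "OT_T \<sigma> a z = (\<chi> i. z $ i + \<sigma> i a)"

definition OT_R :: "('s::finite + 't::finite \<Rightarrow> 'k \<Rightarrow> complex) \<Rightarrow> 'k
    \<Rightarrow> complex ^ ('s + 't) \<Rightarrow> complex ^ ('s + 't)" where
  "OT_R \<sigma> u z = (\<chi> i. \<sigma> i u * z $ i)"

text \<open>The group $\mathcal{O}_K\rtimes U$, through its (faithful) action: as a group of transformations.\<close>

definition OT_group :: "('s::finite + 't::finite \<Rightarrow> 'k::field_char_0 \<Rightarrow> complex) \<Rightarrow> 'k set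
    \<Rightarrow> (complex ^ ('s + 't) \<Rightarrow> complex ^ ('s + 't)) set" where
  "OT_group \<sigma> U = {OT_T \<sigma> a \<circ> OT_R \<sigma> u | a u. a \<in> int_ring \<and> u \<in> U}"

text \<open>The quotient map $\pi$; points of $M_K$ are the \<open>OT_group\<close>-orbits.\<close>

definition OT_proj :: "('s::finite + 't::finite \<Rightarrow> 'k::field_char_0 \<Rightarrow> complex) \<Rightarrow> 'k set
    \<Rightarrow> complex ^ ('s + 't) \<Rightarrow> (complex ^ ('s + 't)) set" where
  "OT_proj \<sigma> U z = {\<gamma> z | \<gamma>. \<gamma> \<in> OT_group \<sigma> U}"

definition OT_manifold :: "('s::finite + 't::finite \<Rightarrow> 'k::field_char_0 \<Rightarrow> complex) \<Rightarrow> 'k set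
    \<Rightarrow> (complex ^ ('s + 't)) set set" where
  "OT_manifold \<sigma> U = OT_proj \<sigma> U ` HC"

definition OT_preimage :: "('s::finite + 't::finite \<Rightarrow> 'k::field_char_0 \<Rightarrow> complex) \<Rightarrow> 'k set
    \<Rightarrow> (complex ^ ('s + 't)) set set \<Rightarrow> (complex ^ ('s + 't)) set" where
  "OT_preimage \<sigma> U V = {z \<in> HC. OT_proj \<sigma> U z \<in> V}"

definition OT_topology :: "('s::finite + 't::finite \<Rightarrow> 'k::field_char_0 \<Rightarrow> complex) \<Rightarrow> 'k set
    \<Rightarrow> (complex ^ ('s + 't)) set topology" where
  "OT_topology \<sigma> U =
     topology (\<lambda>V. V \<subseteq> OT_manifold \<sigma> U \<and> openin (top_of_set HC) (OT_preimage \<sigma> U V))"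

lemma openin_OT_topology:
  "openin (OT_topology \<sigma> U) V \<longleftrightarrow>
     V \<subseteq> OT_manifold \<sigma> U \<and> openin (top_of_set HC) (OT_preimage \<sigma> U V)"
proof -
  have "istopology (\<lambda>V. V \<subseteq> OT_manifold \<sigma> U \<and> openin (top_of_set HC) (OT_preimage \<sigma> U V))"
    unfolding istopology_def
  proof (intro conjI allI impI)
    fix S T
    assume "S \<subseteq> OT_manifold \<sigma> U \<and> openin (top_of_set HC) (OT_preimage \<sigma> U S)"
      and "T \<subseteq> OT_manifold \<sigma> U \<and> openin (top_of_set HC) (OT_preimage \<sigma> U T)"
    moreover have "OT_preimage \<sigma> U (S \<inter> T) = OT_preimage \<sigma> U S \<inter> OT_preimage \<sigma> U T"
      by (auto simp: OT_preimage_def)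
    ultimately show "openin (top_of_set HC) (OT_preimage \<sigma> U (S \<inter> T))"
      by (simp add: openin_Int)
  next
    fix \<V>
    assume "\<forall>V\<in>\<V>. V \<subseteq> OT_manifold \<sigma> U \<and> openin (top_of_set HC) (OT_preimage \<sigma> U V)"
    moreover have "OT_preimage \<sigma> U (\<Union>\<V>) = \<Union>(OT_preimage \<sigma> U ` \<V>)"
      by (auto simp: OT_preimage_def)
    ultimately show "openin (top_of_set HC) (OT_preimage \<sigma> U (\<Union>\<V>))"
      by auto
  qed (auto simp: OT_preimage_def)
  then show ?thesis
    by (simp add: OT_topology_def topology_inverse')
qed

lemma quotient_map_OT_proj:
  "quotient_map (top_of_set HC) (OT_topology \<sigma> U) (OT_proj \<sigma> U)"
proof -
  have "OT_preimage \<sigma> U (OT_manifold \<sigma> U) = HC"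
    by (auto simp: OT_preimage_def OT_manifold_def)
  then have "topspace (OT_topology \<sigma> U) = OT_manifold \<sigma> U"
    unfolding topspace_def openin_OT_topology
    by (metis (no_types, lifting) Sup_upper Union_least mem_Collect_eq openin_topspace
        subset_antisym subset_refl topspace_euclidean_subtopology)
  then show ?thesis
    by (simp add: quotient_map_def openin_OT_topology OT_preimage_def OT_manifold_def)
qed

section \<open>Holomorphic functions and analytic subvarieties\<close>

text \<open>Holomorphic functions of several complex variables: complex differentiable on an open set.\<close>

definition mv_holomorphic_on :: "(complex ^ 'n::finite \<Rightarrow> complex) \<Rightarrow> (complex ^ 'n) set \<Rightarrow> bool" where
  "mv_holomorphic_on f S \<longleftrightarrow> open S \<and>
     (\<forall>z\<in>S. \<exists>D. Vector_Spaces.linear (*s) (*) D \<and> (f has_derivative D) (at z))"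

text \<open>$M_K$ carries the unique complex structure making $\pi$ a local biholomorphism: a function on
  an open subset of $M_K$ is holomorphic iff its pullback along $\pi$ is.\<close>

definition OT_holomorphic_on :: "('s::finite + 't::finite \<Rightarrow> 'k::field_char_0 \<Rightarrow> complex) \<Rightarrow> 'k set
    \<Rightarrow> ((complex ^ ('s + 't)) set \<Rightarrow> complex) \<Rightarrow> (complex ^ ('s + 't)) set set \<Rightarrow> bool" where
  "OT_holomorphic_on \<sigma> U f V \<longleftrightarrow>
     openin (OT_topology \<sigma> U) V \<and> mv_holomorphic_on (f \<circ> OT_proj \<sigma> U) (OT_preimage \<sigma> U V)"

definition OT_analytic_subvariety :: "('s::finite + 't::finite \<Rightarrow> 'k::field_char_0 \<Rightarrow> complex)
    \<Rightarrow> 'k set \<Rightarrow> (complex ^ ('s + 't)) set set \<Rightarrow> bool" where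
  "OT_analytic_subvariety \<sigma> U A \<longleftrightarrow>
     closedin (OT_topology \<sigma> U) A \<and>
     (\<forall>p \<in> OT_manifold \<sigma> U. \<exists>V F.
        p \<in> V \<and> openin (OT_topology \<sigma> U) V \<and> finite F \<and>
        (\<forall>f\<in>F. OT_holomorphic_on \<sigma> U f V) \<and>
        A \<inter> V = {q \<in> V. \<forall>f\<in>F. f q = 0})"

section \<open>The foliation\<close>

text \<open>The complex span of $\partial/\partial z_{s+1},\dots,\partial/\partial z_{s+t}$ in the tangent
  space $\mathbb{C}^{s+t}$ of $\mathbb{H}^s\times\mathbb{C}^t$ (the same at every point).\<close>

definition OT_distribution :: "(complex ^ ('s::finite + 't::finite)) set" where
  "OT_distribution = vec.span {axis (Inr j) 1 | j :: 't. True}"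

text \<open>A $C^1$ curve $[0,1]\to M_K$ tangent to $\Sigma$. As $\pi$ is a local biholomorphism and
  $\pi^*\Sigma$ is spanned by \<open>OT_distribution\<close>, this is expressed by local lifts along $\pi$.\<close>

definition OT_tangent_curve :: "('s::finite + 't::finite \<Rightarrow> 'k::field_char_0 \<Rightarrow> complex) \<Rightarrow> 'k set
    \<Rightarrow> (real \<Rightarrow> (complex ^ ('s + 't)) set) \<Rightarrow> bool" where
  "OT_tangent_curve \<sigma> U c \<longleftrightarrow>
     (\<forall>r\<in>{0..1}. \<exists>e>0. \<exists>g D.
        continuous_on (ball r e \<inter> {0..1}) D \<and>
        (\<forall>x \<in> ball r e \<inter> {0..1}.
           g x \<in> HC \<and> OT_proj \<sigma> U (g x) = c x \<and>
           (g has_vector_derivative D x) (at x within {0..1}) \<and> D x \<in> OT_distribution))"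

text \<open>The leaf through \<open>p\<close>, i.e. the maximal connected integral manifold of $\Sigma$ through \<open>p\<close>:
  all points joined to \<open>p\<close> by a curve tangent to $\Sigma$.\<close>

definition OT_leaf :: "('s::finite + 't::finite \<Rightarrow> 'k::field_char_0 \<Rightarrow> complex) \<Rightarrow> 'k set
    \<Rightarrow> (complex ^ ('s + 't)) set \<Rightarrow> (complex ^ ('s + 't)) set set" where
  "OT_leaf \<sigma> U p = {q. \<exists>c. OT_tangent_curve \<sigma> U c \<and> c 0 = p \<and> c 1 = q}"

definition OT_leaves :: "('s::finite + 't::finite \<Rightarrow> 'k::field_char_0 \<Rightarrow> complex) \<Rightarrow> 'k set
    \<Rightarrow> (complex ^ ('s + 't)) set set set" where
  "OT_leaves \<sigma> U = OT_leaf \<sigma> U ` OT_manifold \<sigma> U"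

definition Z_alpha :: "('s \<Rightarrow> real) \<Rightarrow> (complex ^ ('s::finite + 't::finite)) set" where
  "Z_alpha \<alpha> = {z \<in> HC. \<forall>i. Im (z $ Inl i) = \<alpha> i}"

end

theory Submission
  imports Defs "HOL-Complex_Analysis.Conformal_Mappings" "Jordan_Normal_Form.Char_Poly"
begin

text \<open>
  On the universal cover $\mathbb{H}^s\times\mathbb{C}^t$ the leaf through the image of $z^0$
  contains the image of the whole slice $z_i=z^0_i$ $(i\le s)$, hence, by
  $\mathcal{O}_K$-invariance, the image of every slice $z_i=z^0_i+\sigma_i(a)$ $(i\le s)$ with
  $a\in\mathcal{O}_K$. Both claims then rest on one arithmetic and one analytic fact.

  Arithmetic: the vectors $(\sigma_1(a),\dots,\sigma_s(a))$, $a\in\mathcal{O}_K$, are dense in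
  $\mathbb{R}^s$ (\<open>int_ring_dense_in_real_embeddings\<close>). So the slices above come arbitrarily close to
  every point whose first $s$ coordinates have the same imaginary parts as those of $z^0$, and this
  is (i) with $\alpha_i=\mathrm{Im}\, z^0_i$. The density comes from the logarithmic lattice of $U$.
  Since it is full, there are units $u\in U$ whose logarithms
  $\log\sigma_i(u)$ approximate any prescribed real vector up to a bounded error. Prescribing one
  large entry shows that the vectors $(\sigma_i(u))_{i\le s}$ lie in no hyperplane, so the image of
  $\mathcal{O}_K$ spans $\mathbb{R}^s$ and, being an additive group, approximates every vector up to
  some bounded error $C$. Prescribing negative entries gives a unit $u$ with all
  $0<\sigma_i(u)<1$; multiplication by $u^n$ maps $\mathcal{O}_K$ to itself and shrinks the error
  to $C\max_i\sigma_i(u)^n$.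

  Analysis: the set $\mathrm{Im}\, z_i=\alpha_i$ $(i\le s)$ is a product of $s$ real lines and
  $\mathbb{C}^t$, so a holomorphic function vanishing on it near one of its points vanishes near
  that point (\<open>mv_holomorphic_zero_on_Z_alpha\<close>). If an analytic subvariety contains $Z$, the functions
  defining its preimage therefore vanish on a nonempty open set; by the identity theorem the
  interior of the preimage is open and closed in the connected space
  $\mathbb{H}^s\times\mathbb{C}^t$, which gives (ii). Both uses of the identity theorem reduce to
  one complex variable by restriction to a complex line.
\<close>

text \<open>Throughout, \<open>$\<close> denotes components in finite Cartesian products.\<close>

no_notation fps_nth (infixl "$" 75)
no_notation vec_index (infixl "$" 100)

section \<open>Algebraic integers form a ring\<close>

text \<open>With this scaling the field is a $\mathbb{Z}$-module, in which spans with integer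
  coefficients are available.\<close>
definition int_scale :: "int \<Rightarrow> 'a \<Rightarrow> 'a::comm_ring_1" where
  "int_scale c x = of_int c * x"

interpretation zmod: Modules.module "int_scale :: int \<Rightarrow> 'a \<Rightarrow> 'a::comm_ring_1"
  by unfold_locales (simp_all add: int_scale_def algebra_simps)

text \<open>Multiplication by \<open>x\<close> on the span of \<open>S\<close> is described by an integer matrix, of which \<open>x\<close> is
  an eigenvalue with the vector of all elements of \<open>S\<close> as eigenvector. The characteristic
  polynomial of that matrix is monic with integer coefficients.\<close>
lemma algebraic_int_if_stabilizes:
  fixes x :: "'a::field_char_0"
  assumes S: "finite S" "s0 \<in> S" "s0 \<noteq> 0"
    and stab: "\<And>s. s \<in> S \<Longrightarrow> x * s \<in> zmod.span S"
  shows "algebraic_int x"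
proof -
  obtain bs where bs: "set bs = S" "distinct bs"
    using finite_distinct_list[OF S(1)] by blast
  define n where "n = length bs"
  have "\<exists>u. x * s = (\<Sum>v\<in>S. of_int (u v) * v)" if "s \<in> S" for s
    using stab[OF that] unfolding zmod.span_finite[OF S(1)] by (auto simp: int_scale_def)
  then obtain u where u: "\<And>s. s \<in> S \<Longrightarrow> x * s = (\<Sum>v\<in>S. of_int (u s v) * v)"
    by metis
  define A :: "int mat" where "A = mat n n (\<lambda>(i, j). u (bs ! i) (bs ! j))"
  define v where "v = Matrix.vec n (\<lambda>i. bs ! i)"
  have A: "A \<in> carrier_mat n n"
    by (simp add: A_def)
  have mA: "(map_mat of_int A :: 'a mat) \<in> carrier_mat n n"
    using A by simp
  have bij: "bij_betw ((!) bs) {0..<n} S"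
    using bij_betw_nth[OF bs(2), of "{..<n}" S] bs(1) by (simp add: n_def atLeast0LessThan)
  have "map_mat of_int A *\<^sub>v v = x \<cdot>\<^sub>v v"
  proof (rule eq_vecI)
    fix i assume "i < dim_vec (x \<cdot>\<^sub>v v)"
    then have i: "i < n" by (simp add: v_def)
    have "vec_index (map_mat of_int A *\<^sub>v v) i
        = (\<Sum>j = 0..<n. of_int (u (bs ! i) (bs ! j)) * bs ! j)"
      using i by (simp add: A_def v_def scalar_prod_def)
    also have "\<dots> = (\<Sum>w\<in>S. of_int (u (bs ! i) w) * w)"
      using sum.reindex_bij_betw[OF bij, of "\<lambda>w. of_int (u (bs ! i) w) * w"] by simp
    also have "\<dots> = x * bs ! i"
      using u[of "bs ! i"] i bs(1) n_def by (metis nth_mem)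
    finally show "vec_index (map_mat of_int A *\<^sub>v v) i = vec_index (x \<cdot>\<^sub>v v) i"
      using i by (simp add: v_def)
  qed (simp add: A_def v_def)
  moreover have "v \<noteq> 0\<^sub>v n"
  proof
    assume v0: "v = 0\<^sub>v n"
    obtain i where i: "i < n" "bs ! i = s0"
      using S(2) bs(1) by (metis in_set_conv_nth n_def)
    then have "vec_index v i = s0" by (simp add: v_def)
    then show False using v0 i S(3) by simp
  qed
  ultimately have "eigenvalue (map_mat of_int A) x"
    unfolding eigenvalue_def eigenvector_def by (auto intro!: exI[of _ v] simp: A_def v_def)
  then have "poly (map_poly of_int (char_poly A)) x = 0"
    using eigenvalue_root_char_poly[OF mA] of_int_hom.char_poly_hom[OF A] by metis
  moreover have "lead_coeff (char_poly A) = 1"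
    using degree_monic_char_poly[OF A] by simp
  ultimately show ?thesis
    by (auto simp: algebraic_int_altdef_ipoly)
qed

lemma zmod_span_mult:
  fixes c :: "'a::comm_ring_1"
  assumes "t \<in> zmod.span T" and "\<And>s. s \<in> T \<Longrightarrow> c * s \<in> zmod.span S"
  shows "c * t \<in> zmod.span S"
  using assms(1)
proof (induction rule: zmod.span_induct_alt)
  case (step k s y)
  have "c * (int_scale k s + y) = int_scale k (c * s) + c * y"
    by (simp add: int_scale_def algebra_simps)
  then show ?case
    using step assms(2) by (simp add: zmod.span_add zmod.span_scale)
qed (simp add: zmod.span_zero)

lemma algebraic_int_power_reduction:
  fixes x :: "'a::field_char_0"
  assumes "algebraic_int x"
  obtains m where "m > 0" "x ^ m \<in> zmod.span ((\<lambda>i. x ^ i) ` {..<m})"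
proof -
  obtain p where p: "poly (map_poly of_int p) x = 0" "lead_coeff p = 1"
    using assms by (auto simp: algebraic_int_altdef_ipoly)
  define m where "m = degree p"
  have deg: "degree (map_poly of_int p :: 'a poly) = m"
    by (simp add: m_def)
  have "m \<noteq> 0"
  proof
    assume "m = 0"
    then have "p = 1"
      using p(2) by (metis degree_0_id m_def one_pCons)
    then show False using p(1) by simp
  qed
  have "0 = (\<Sum>i\<le>m. of_int (coeff p i) * x ^ i)"
    using p(1) by (simp add: poly_altdef m_def)
  also have "\<dots> = (\<Sum>i<m. of_int (coeff p i) * x ^ i) + x ^ m"
    using p(2) by (simp add: m_def lessThan_Suc_atMost[symmetric])
  finally have "x ^ m = (\<Sum>i<m. int_scale (- coeff p i) (x ^ i))"
    by (simp add: int_scale_def sum_negf eq_neg_iff_add_eq_0 add.commute)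
  moreover have "\<dots> \<in> zmod.span ((\<lambda>i. x ^ i) ` {..<m})"
    by (intro zmod.span_sum zmod.span_scale zmod.span_base imageI)
  ultimately show ?thesis
    using that[of m] \<open>m \<noteq> 0\<close> by simp
qed

text \<open>The monomials $x^iy^j$ below the degrees of two monic equations for \<open>x\<close> and \<open>y\<close> span a
  $\mathbb{Z}$-module stable under both, hence also under $x+y$ and $xy$.\<close>
lemma algebraic_int_pair_stabilizes:
  fixes x y :: "'a::field_char_0"
  assumes "algebraic_int x" "algebraic_int y"
  obtains S where "finite S" "1 \<in> S"
    "\<And>s. s \<in> S \<Longrightarrow> x * s \<in> zmod.span S" "\<And>s. s \<in> S \<Longrightarrow> y * s \<in> zmod.span S"
proof -
  obtain m where m: "m > 0" "x ^ m \<in> zmod.span ((\<lambda>i. x ^ i) ` {..<m})"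
    using algebraic_int_power_reduction[OF assms(1)] .
  obtain n where n: "n > 0" "y ^ n \<in> zmod.span ((\<lambda>i. y ^ i) ` {..<n})"
    using algebraic_int_power_reduction[OF assms(2)] .
  define S where "S = (\<lambda>(i, j). x ^ i * y ^ j) ` ({..<m} \<times> {..<n})"
  have "x * (x ^ i * y ^ j) \<in> zmod.span S" if "i < m" "j < n" for i j
  proof (cases "Suc i < m")
    case True
    then have "x * (x ^ i * y ^ j) \<in> S"
      using that unfolding S_def by (intro image_eqI[of _ _ "(Suc i, j)"]) auto
    then show ?thesis by (rule zmod.span_base)
  next
    case False
    then have "x * (x ^ i * y ^ j) = y ^ j * x ^ m"
      using that by (metis Suc_lessI mult.assoc mult.commute power_Suc)
    moreover have "y ^ j * x ^ m \<in> zmod.span S"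
      using that by (intro zmod_span_mult[OF m(2)] zmod.span_base) (auto simp: S_def mult.commute)
    ultimately show ?thesis by (simp only:)
  qed
  moreover have "y * (x ^ i * y ^ j) \<in> zmod.span S" if "i < m" "j < n" for i j
  proof (cases "Suc j < n")
    case True
    then have "y * (x ^ i * y ^ j) \<in> S"
      using that unfolding S_def by (intro image_eqI[of _ _ "(i, Suc j)"]) auto
    then show ?thesis by (rule zmod.span_base)
  next
    case False
    then have "y * (x ^ i * y ^ j) = x ^ i * y ^ n"
      using that by (metis Suc_lessI mult.left_commute power_Suc)
    moreover have "x ^ i * y ^ n \<in> zmod.span S"
      using that by (intro zmod_span_mult[OF n(2)] zmod.span_base) (auto simp: S_def)
    ultimately show ?thesis by (simp only:)
  qed
  moreover have "1 \<in> S"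
    unfolding S_def using m(1) n(1) by (intro image_eqI[of _ _ "(0, 0)"]) auto
  moreover have "finite S"
    by (simp add: S_def)
  ultimately show ?thesis
    by (intro that[of S]) (auto simp: S_def)
qed

lemma algebraic_int_add:
  fixes x y :: "'a::field_char_0"
  assumes "algebraic_int x" "algebraic_int y"
  shows "algebraic_int (x + y)"
proof -
  obtain S where S: "finite S" "1 \<in> S"
    "\<And>s. s \<in> S \<Longrightarrow> x * s \<in> zmod.span S" "\<And>s. s \<in> S \<Longrightarrow> y * s \<in> zmod.span S"
    using algebraic_int_pair_stabilizes[OF assms] by metis
  then show ?thesis
    by (intro algebraic_int_if_stabilizes[of S 1]) (auto simp: distrib_right intro: zmod.span_add)
qed

lemma algebraic_int_mult:
  fixes x y :: "'a::field_char_0"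
  assumes "algebraic_int x" "algebraic_int y"
  shows "algebraic_int (x * y)"
proof -
  obtain S where S: "finite S" "1 \<in> S"
    "\<And>s. s \<in> S \<Longrightarrow> x * s \<in> zmod.span S" "\<And>s. s \<in> S \<Longrightarrow> y * s \<in> zmod.span S"
    using algebraic_int_pair_stabilizes[OF assms] by metis
  then show ?thesis
    by (intro algebraic_int_if_stabilizes[of S 1])
      (auto simp: mult.assoc intro: zmod_span_mult[where S = S and T = S])
qed

section \<open>Relatively dense subgroups of Euclidean space\<close>

text \<open>Rounding down the coordinates with respect to a basis taken from \<open>G\<close> moves a vector by at
  most the sum of the lengths of the basis vectors.\<close>
lemma additive_span_relatively_dense:
  fixes G :: "'a::euclidean_space set"
  assumes zero: "0 \<in> G" and add: "\<And>x y. x \<in> G \<Longrightarrow> y \<in> G \<Longrightarrow> x + y \<in> G"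
    and minus: "\<And>x. x \<in> G \<Longrightarrow> - x \<in> G" and span: "span G = UNIV"
  obtains C where "\<And>v. \<exists>g\<in>G. norm (v - g) \<le> C"
proof -
  obtain B where B: "B \<subseteq> G" "independent B" "G \<subseteq> span B"
    by (rule maximal_independent_subset)
  have fin: "finite B"
    using B(2) by (rule finiteI_independent)
  have spanB: "span B = UNIV"
    using B(3) span span_mono[of G "span B"] by (simp add: span_span) blast
  have nat_mult: "of_nat n *\<^sub>R g \<in> G" if "g \<in> G" for n g
    using that by (induction n) (auto simp: zero add scaleR_left_distrib)
  have int_mult: "of_int k *\<^sub>R g \<in> G" if "g \<in> G" for k g
    using nat_mult[OF that] minus[OF nat_mult[OF that]] by (cases k rule: int_cases2) simp_all
  have sum_mem: "(\<Sum>b\<in>F. f b) \<in> G" if "finite F" "\<And>b. b \<in> F \<Longrightarrow> f b \<in> G" for F and f :: "'a \<Rightarrow> 'a"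
    using that by (induction F rule: finite_induct) (auto simp: zero add)
  show ?thesis
  proof (rule that[of "\<Sum>b\<in>B. norm b"])
    fix v
    have "v \<in> range (\<lambda>r. \<Sum>b\<in>B. r b *\<^sub>R b)"
      using spanB span_finite[OF fin] by auto
    then obtain r where r: "v = (\<Sum>b\<in>B. r b *\<^sub>R b)" by auto
    define g where "g = (\<Sum>b\<in>B. of_int \<lfloor>r b\<rfloor> *\<^sub>R b)"
    have "v - g = (\<Sum>b\<in>B. (r b - of_int \<lfloor>r b\<rfloor>) *\<^sub>R b)"
      by (simp add: r g_def sum_subtractf scaleR_left_diff_distrib)
    also have "norm \<dots> \<le> (\<Sum>b\<in>B. norm b)"
    proof (rule sum_norm_le)
      fix b
      have "\<bar>r b - of_int \<lfloor>r b\<rfloor>\<bar> \<le> 1"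
        by linarith
      then show "norm ((r b - of_int \<lfloor>r b\<rfloor>) *\<^sub>R b) \<le> norm b"
        by (simp add: mult_left_le_one_le)
    qed
    finally have "norm (v - g) \<le> (\<Sum>b\<in>B. norm b)" .
    moreover have "g \<in> G"
      using B(1) unfolding g_def by (intro sum_mem[OF fin] int_mult) auto
    ultimately show "\<exists>g\<in>G. norm (v - g) \<le> (\<Sum>b\<in>B. norm b)" by blast
  qed
qed

lemma full_lattice_relatively_dense:
  fixes \<Lambda> :: "(real ^ 's::finite) set"
  assumes "full_lattice \<Lambda>"
  obtains C where "\<And>v. \<exists>g\<in>\<Lambda>. norm (v - g) \<le> C"
proof -
  obtain b :: "'s \<Rightarrow> real ^ 's" where b: "inj b" "independent (range b)"
    and \<Lambda>: "\<Lambda> = {\<Sum>i\<in>UNIV. of_int (c i) *\<^sub>R b i | c :: 's \<Rightarrow> int. True}"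
    using assms by (auto simp: full_lattice_def)
  have mem: "(\<Sum>i\<in>UNIV. of_int (c i) *\<^sub>R b i) \<in> \<Lambda>" for c :: "'s \<Rightarrow> int"
    using \<Lambda> by auto
  have "b i \<in> \<Lambda>" for i
  proof -
    have "(\<Sum>j\<in>UNIV. of_int (if j = i then 1 else 0) *\<^sub>R b j) = (\<Sum>j\<in>UNIV. if j = i then b j else 0)"
      by (intro sum.cong) auto
    then show ?thesis
      using mem[of "\<lambda>j. if j = i then 1 else 0"] by simp
  qed
  then have sub: "range b \<subseteq> \<Lambda>" by auto
  have "card (range b) = dim (UNIV :: (real ^ 's) set)"
    using b(1) by (simp add: card_image)
  then have "span (range b) = UNIV"
    using b(2) card_eq_dim[of "range b" UNIV] by auto
  then have span: "span \<Lambda> = UNIV"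
    using span_mono[OF sub] by auto
  show ?thesis
  proof (rule additive_span_relatively_dense[OF _ _ _ span])
    show "0 \<in> \<Lambda>" using mem[of "\<lambda>_. 0"] by simp
    show "x + y \<in> \<Lambda>" if xy: "x \<in> \<Lambda>" "y \<in> \<Lambda>" for x y
    proof -
      obtain c d :: "'s \<Rightarrow> int" where "x = (\<Sum>i\<in>UNIV. of_int (c i) *\<^sub>R b i)"
        "y = (\<Sum>i\<in>UNIV. of_int (d i) *\<^sub>R b i)"
        using xy \<Lambda> by blast
      then have "x + y = (\<Sum>i\<in>UNIV. of_int (c i + d i) *\<^sub>R b i)"
        by (simp add: sum.distrib scaleR_left_distrib)
      then show ?thesis using mem[of "\<lambda>i. c i + d i"] by (simp only:)
    qed
    show "- x \<in> \<Lambda>" if x: "x \<in> \<Lambda>" for x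
    proof -
      obtain c :: "'s \<Rightarrow> int" where "x = (\<Sum>i\<in>UNIV. of_int (c i) *\<^sub>R b i)"
        using x \<Lambda> by blast
      then have "- x = (\<Sum>i\<in>UNIV. of_int (- c i) *\<^sub>R b i)"
        by (simp add: sum_negf)
      then show ?thesis using mem[of "\<lambda>i. - c i"] by (simp only:)
    qed
  qed (rule that)
qed

section \<open>Density of the integers in the real embeddings\<close>

lemma embedding_numbering_complex:
  assumes "embedding_numbering \<sigma>"
  shows "\<sigma> k \<in> complex_embeddings"
proof (cases k)
  case (Inl i)
  then show ?thesis
    using assms by (auto simp: embedding_numbering_def bij_betw_def real_embeddings_def)
next
  case (Inr j)
  have "case_sum (\<lambda>j. \<sigma> (Inr j)) (\<lambda>j x. cnj (\<sigma> (Inr j) x)) (Inl j) \<in> nonreal_embeddings"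
    using assms unfolding embedding_numbering_def by (blast intro: bij_betw_apply)
  then show ?thesis
    using Inr by (simp add: nonreal_embeddings_def)
qed

lemma embedding_numbering_real:
  assumes "embedding_numbering \<sigma>"
  shows "\<sigma> (Inl i) x = of_real (Re (\<sigma> (Inl i) x))"
proof -
  have "\<sigma> (Inl i) \<in> real_embeddings"
    using assms by (auto simp: embedding_numbering_def bij_betw_def)
  then show ?thesis
    by (auto simp: real_embeddings_def subset_iff)
qed

lemma complex_embeddings_simps:
  assumes "f \<in> complex_embeddings"
  shows "f 0 = 0" "f 1 = 1" "f (x + y) = f x + f y" "f (- x) = - f x" "f (x * y) = f x * f y"
    "f (x ^ n) = f x ^ n"
proof -
  show "f 1 = 1" and add: "\<And>x y. f (x + y) = f x + f y" and mult: "f (x * y) = f x * f y" for x y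
    using assms by (auto simp: complex_embeddings_def)
  show zero: "f 0 = 0"
    using add[of 0 0] by simp
  show "f (- x) = - f x"
    using add[of x "- x"] zero by (simp add: eq_neg_iff_add_eq_0 add.commute)
  show "f (x ^ n) = f x ^ n"
    using assms by (induction n) (auto simp: complex_embeddings_def)
qed

definition real_embedding_vec ::
    "('s::finite + 't::finite \<Rightarrow> 'k::field_char_0 \<Rightarrow> complex) \<Rightarrow> 'k \<Rightarrow> real ^ 's" where
  "real_embedding_vec \<sigma> x = (\<chi> i. Re (\<sigma> (Inl i) x))"

lemma real_embedding_vec_simps:
  assumes "embedding_numbering \<sigma>"
  shows "real_embedding_vec \<sigma> 0 = 0"
    "real_embedding_vec \<sigma> (x + y) = real_embedding_vec \<sigma> x + real_embedding_vec \<sigma> y"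
    "real_embedding_vec \<sigma> (- x) = - real_embedding_vec \<sigma> x"
    "real_embedding_vec \<sigma> (x * y) $ i = real_embedding_vec \<sigma> x $ i * real_embedding_vec \<sigma> y $ i"
    "real_embedding_vec \<sigma> (x ^ n) $ i = real_embedding_vec \<sigma> x $ i ^ n"
proof -
  note hom = complex_embeddings_simps[OF embedding_numbering_complex[OF assms]]
  show "real_embedding_vec \<sigma> 0 = 0"
    "real_embedding_vec \<sigma> (x + y) = real_embedding_vec \<sigma> x + real_embedding_vec \<sigma> y"
    "real_embedding_vec \<sigma> (- x) = - real_embedding_vec \<sigma> x"
    by (simp_all add: real_embedding_vec_def hom Finite_Cartesian_Product.vec_eq_iff)
  have "of_real (Re (\<sigma> (Inl i) (x * y))) = (of_real (Re (\<sigma> (Inl i) x) * Re (\<sigma> (Inl i) y)) :: complex)"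
    unfolding of_real_mult embedding_numbering_real[OF assms, symmetric] by (rule hom)
  then show "real_embedding_vec \<sigma> (x * y) $ i = real_embedding_vec \<sigma> x $ i * real_embedding_vec \<sigma> y $ i"
    by (simp add: real_embedding_vec_def del: of_real_mult)
  have "of_real (Re (\<sigma> (Inl i) (x ^ n))) = (of_real (Re (\<sigma> (Inl i) x) ^ n) :: complex)"
    unfolding of_real_power embedding_numbering_real[OF assms, symmetric] by (rule hom)
  then show "real_embedding_vec \<sigma> (x ^ n) $ i = real_embedding_vec \<sigma> x $ i ^ n"
    by (simp add: real_embedding_vec_def del: of_real_power)
qed

lemma int_ring_closed:
  shows "0 \<in> int_ring" "x \<in> int_ring \<Longrightarrow> y \<in> int_ring \<Longrightarrow> x + y \<in> int_ring"
    "x \<in> int_ring \<Longrightarrow> - x \<in> int_ring" "x \<in> int_ring \<Longrightarrow> y \<in> int_ring \<Longrightarrow> x * y \<in> int_ring"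
    "x \<in> int_ring \<Longrightarrow> x ^ n \<in> int_ring"
proof -
  show "0 \<in> int_ring" "x \<in> int_ring \<Longrightarrow> y \<in> int_ring \<Longrightarrow> x + y \<in> int_ring"
    "x \<in> int_ring \<Longrightarrow> - x \<in> int_ring" "x \<in> int_ring \<Longrightarrow> y \<in> int_ring \<Longrightarrow> x * y \<in> int_ring"
    by (auto simp: int_ring_def algebraic_int_add algebraic_int_mult)
  show "x \<in> int_ring \<Longrightarrow> x ^ n \<in> int_ring"
    by (induction n) (auto simp: int_ring_def algebraic_int_mult)
qed

lemma admissible_subset_int_ring:
  assumes "admissible \<sigma> U"
  shows "U \<subseteq> int_ring"
  using assms by (auto simp: admissible_def pos_units_def int_units_def)

text \<open>Relative density of the logarithmic lattice, in multiplicative form: the values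
  $\sigma_1(u),\dots,\sigma_s(u)$ can be prescribed up to one common bounded factor.\<close>
lemma admissible_unit_with_given_logs:
  fixes \<sigma> :: "'s::finite + 't::finite \<Rightarrow> 'k::field_char_0 \<Rightarrow> complex"
  assumes "admissible \<sigma> U"
  obtains C where "\<And>v :: 's \<Rightarrow> real. \<exists>u\<in>U. \<forall>i.
    exp (v i - C) \<le> real_embedding_vec \<sigma> u $ i \<and> real_embedding_vec \<sigma> u $ i \<le> exp (v i + C)"
proof -
  obtain C where C: "\<And>v. \<exists>g\<in>log_embedding \<sigma> ` U. norm (v - g) \<le> C"
    using assms full_lattice_relatively_dense unfolding admissible_def by metis
  show ?thesis
  proof (rule that[of C])
    fix v :: "'s \<Rightarrow> real"
    obtain u where u: "u \<in> U" "norm ((\<chi> i. v i) - log_embedding \<sigma> u) \<le> C"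
      using C[of "\<chi> i. v i"] by auto
    have "exp (v i - C) \<le> real_embedding_vec \<sigma> u $ i \<and> real_embedding_vec \<sigma> u $ i \<le> exp (v i + C)" for i
    proof -
      have pos: "real_embedding_vec \<sigma> u $ i > 0"
        using u(1) assms by (auto simp: admissible_def pos_units_def real_embedding_vec_def)
      have "\<bar>v i - ln (real_embedding_vec \<sigma> u $ i)\<bar> \<le> C"
        using component_le_norm_cart[of "(\<chi> i. v i) - log_embedding \<sigma> u" i] u(2)
        by (simp add: log_embedding_def real_embedding_vec_def)
      then show ?thesis
        using pos by (auto simp: abs_le_iff ln_ge_iff[symmetric] algebra_simps
          simp flip: ln_le_cancel_iff[OF _ exp_gt_zero])
    qed
    then show "\<exists>u\<in>U. \<forall>i. exp (v i - C) \<le> real_embedding_vec \<sigma> u $ i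
        \<and> real_embedding_vec \<sigma> u $ i \<le> exp (v i + C)"
      using u(1) by blast
  qed
qed

text \<open>A linear relation with a nonzero \<open>k\<close>-th coefficient fails on a unit whose \<open>k\<close>-th conjugate
  is large while all its other real conjugates are bounded. This plays the role of the linear
  independence of distinct characters.\<close>
lemma span_real_embedding_vec_units:
  fixes \<sigma> :: "'s::finite + 't::finite \<Rightarrow> 'k::field_char_0 \<Rightarrow> complex"
  assumes "admissible \<sigma> U"
  shows "span (real_embedding_vec \<sigma> ` U) = UNIV"
proof (rule ccontr)
  assume "span (real_embedding_vec \<sigma> ` U) \<noteq> UNIV"
  then have "span (real_embedding_vec \<sigma> ` U) \<subset> span UNIV"
    by auto
  then obtain a :: "real ^ 's" where a: "a \<noteq> 0"
    "\<And>y. y \<in> span (real_embedding_vec \<sigma> ` U) \<Longrightarrow> Linear_Algebra.orthogonal a y"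
    by (rule orthogonal_to_subspace_exists_gen) blast
  obtain k where k: "a $ k \<noteq> 0"
    using a(1) by (auto simp: Finite_Cartesian_Product.vec_eq_iff)
  obtain C where C: "\<And>v :: 's \<Rightarrow> real. \<exists>u\<in>U. \<forall>i.
    exp (v i - C) \<le> real_embedding_vec \<sigma> u $ i \<and> real_embedding_vec \<sigma> u $ i \<le> exp (v i + C)"
    using admissible_unit_with_given_logs[OF assms] by metis
  define M where "M = (\<Sum>i\<in>UNIV. \<bar>a $ i\<bar>)"
  have M: "\<bar>a $ k\<bar> \<le> M"
    unfolding M_def by (intro member_le_sum) auto
  \<comment> \<open>\<open>N\<close> is chosen so that $|a_k|e^{N-C}$, a lower bound for the \<open>k\<close>-th term, is
    \<open>e\<close> times the bound $Me^C$ for the sum of the others.\<close>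
  define N where "N = 2 * C + ln (M / \<bar>a $ k\<bar>) + 1"
  obtain u where u: "u \<in> U" and
    u_bounds: "\<And>i. exp ((if i = k then N else 0) - C) \<le> real_embedding_vec \<sigma> u $ i"
      "\<And>i. real_embedding_vec \<sigma> u $ i \<le> exp ((if i = k then N else 0) + C)"
    using C[of "\<lambda>i. if i = k then N else 0"] by blast
  have pos: "real_embedding_vec \<sigma> u $ i > 0" for i
    using u_bounds(1)[of i] exp_gt_zero less_le_trans by blast
  have "a \<bullet> real_embedding_vec \<sigma> u = 0"
    using a(2) u by (simp add: Linear_Algebra.orthogonal_def span_base)
  then have "(\<Sum>i\<in>UNIV. a $ i * real_embedding_vec \<sigma> u $ i) = 0"
    by (simp add: inner_vec_def)
  then have "a $ k * real_embedding_vec \<sigma> u $ k = - (\<Sum>i\<in>UNIV - {k}. a $ i * real_embedding_vec \<sigma> u $ i)"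
    by (simp add: sum.remove[of UNIV k] eq_neg_iff_add_eq_0)
  then have "\<bar>a $ k\<bar> * real_embedding_vec \<sigma> u $ k = \<bar>\<Sum>i\<in>UNIV - {k}. a $ i * real_embedding_vec \<sigma> u $ i\<bar>"
    using pos[of k] by (metis abs_minus_cancel abs_mult abs_of_pos)
  also have "\<dots> \<le> (\<Sum>i\<in>UNIV - {k}. \<bar>a $ i\<bar> * exp C)"
  proof (intro order_trans[OF sum_abs] sum_mono)
    fix i assume "i \<in> UNIV - {k}"
    then show "\<bar>a $ i * real_embedding_vec \<sigma> u $ i\<bar> \<le> \<bar>a $ i\<bar> * exp C"
      using u_bounds(2)[of i] pos[of i] by (simp add: abs_mult mult_left_mono)
  qed
  also have "\<dots> \<le> M * exp C"
    unfolding M_def sum_distrib_right by (intro sum_mono2) auto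
  finally have "\<bar>a $ k\<bar> * exp (N - C) \<le> M * exp C"
    using u_bounds(1)[of k] by (smt (verit) abs_ge_zero mult_left_mono)
  moreover have "\<bar>a $ k\<bar> * exp (N - C) = M * exp C * exp 1"
  proof -
    have "N - C = C + ln (M / \<bar>a $ k\<bar>) + 1"
      by (simp add: N_def)
    then show ?thesis
      using k M by (simp add: exp_add exp_diff)
  qed
  moreover have "M * exp C * exp 1 > M * exp C * 1"
    using k M by (intro mult_strict_left_mono) auto
  ultimately show False by simp
qed

text \<open>Since the integers span, every vector is within some \<open>C\<close> of an integer. To approximate
  \<open>x\<close>, apply this to \<open>x\<close> divided by the conjugates of $u^n$ and multiply back by $u^n$, where
  all real conjugates of \<open>u\<close> lie strictly between 0 and 1: the error becomes at most
  $C\sigma_i(u)^n$ in the \<open>i\<close>-th coordinate.\<close>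
lemma int_ring_dense_in_real_embeddings:
  fixes \<sigma> :: "'s::finite + 't::finite \<Rightarrow> 'k::field_char_0 \<Rightarrow> complex" and x :: "'s \<Rightarrow> real"
  assumes \<sigma>: "embedding_numbering \<sigma>" and U: "admissible \<sigma> U" and "e > 0"
  obtains a where "a \<in> int_ring" "\<And>i. \<bar>x i - real_embedding_vec \<sigma> a $ i\<bar> < e"
proof -
  note simps = real_embedding_vec_simps[OF \<sigma>]
  have "span (real_embedding_vec \<sigma> ` int_ring) = UNIV"
    using span_mono[OF image_mono[OF admissible_subset_int_ring[OF U]]]
      span_real_embedding_vec_units[OF U] by blast
  then obtain C where C: "\<And>v. \<exists>g\<in>real_embedding_vec \<sigma> ` int_ring. norm (v - g) \<le> C"
  proof (rule additive_span_relatively_dense[rotated 3])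
    show "0 \<in> real_embedding_vec \<sigma> ` int_ring"
      using simps(1) int_ring_closed(1) by (metis image_eqI)
    show "v + w \<in> real_embedding_vec \<sigma> ` int_ring"
      if "v \<in> real_embedding_vec \<sigma> ` int_ring" "w \<in> real_embedding_vec \<sigma> ` int_ring" for v w
      using that by (auto simp flip: simps(2) intro: int_ring_closed(2))
    show "- v \<in> real_embedding_vec \<sigma> ` int_ring" if "v \<in> real_embedding_vec \<sigma> ` int_ring" for v
      using that by (auto simp flip: simps(3) intro: int_ring_closed(3))
  qed blast
  obtain C' where C': "\<And>v :: 's \<Rightarrow> real. \<exists>u\<in>U. \<forall>i.
    exp (v i - C') \<le> real_embedding_vec \<sigma> u $ i \<and> real_embedding_vec \<sigma> u $ i \<le> exp (v i + C')"
    using admissible_unit_with_given_logs[OF U] by metis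
  \<comment> \<open>The upper bound is below 1 because the prescribed logarithms $-C'-1$ are off by at
    most $C'$.\<close>
  obtain u where u: "u \<in> U"
    and u_bounds: "\<And>i. exp (- C' - 1 - C') \<le> real_embedding_vec \<sigma> u $ i"
      "\<And>i. real_embedding_vec \<sigma> u $ i \<le> exp (- 1)"
    using C'[of "\<lambda>_. - C' - 1"] by auto
  have pos: "real_embedding_vec \<sigma> u $ i > 0" for i
    using u_bounds(1)[of i] exp_gt_zero less_le_trans by blast
  have less1: "real_embedding_vec \<sigma> u $ i < 1" for i
    using u_bounds(2)[of i] by (rule le_less_trans) simp
  have "\<forall>\<^sub>F n in sequentially. \<forall>i\<in>UNIV. real_embedding_vec \<sigma> u $ i ^ n * C < e"
  proof (intro eventually_ball_finite ballI)
    fix i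
    have "(\<lambda>n. real_embedding_vec \<sigma> u $ i ^ n * C) \<longlonglongrightarrow> 0 * C"
      using pos[of i] less1[of i] by (intro tendsto_mult tendsto_const LIMSEQ_realpow_zero) auto
    then show "\<forall>\<^sub>F n in sequentially. real_embedding_vec \<sigma> u $ i ^ n * C < e"
      using \<open>e > 0\<close> by (auto dest: order_tendstoD)
  qed auto
  then obtain n where n: "\<And>i. real_embedding_vec \<sigma> u $ i ^ n * C < e"
    by (auto simp: eventually_sequentially)
  define r where "r = (\<lambda>i. real_embedding_vec \<sigma> u $ i ^ n)"
  have r: "r i > 0" for i
    using pos by (simp add: r_def)
  obtain b where b: "b \<in> int_ring" "norm ((\<chi> i. x i / r i) - real_embedding_vec \<sigma> b) \<le> C"
    using C[of "\<chi> i. x i / r i"] by auto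
  show ?thesis
  proof (rule that[of "u ^ n * b"])
    show "u ^ n * b \<in> int_ring"
      using u admissible_subset_int_ring[OF U] b(1) by (auto intro: int_ring_closed)
    fix i
    have "\<bar>x i / r i - real_embedding_vec \<sigma> b $ i\<bar> \<le> C"
      using component_le_norm_cart[of "(\<chi> i. x i / r i) - real_embedding_vec \<sigma> b" i] b(2) by simp
    then have "r i * \<bar>x i / r i - real_embedding_vec \<sigma> b $ i\<bar> \<le> r i * C"
      using r[of i] by (intro mult_left_mono) auto
    moreover have "r i * \<bar>x i / r i - real_embedding_vec \<sigma> b $ i\<bar> = \<bar>x i - r i * real_embedding_vec \<sigma> b $ i\<bar>"
      using r[of i] by (simp add: abs_mult_pos' right_diff_distrib flip: abs_mult_pos)
    ultimately show "\<bar>x i - real_embedding_vec \<sigma> (u ^ n * b) $ i\<bar> < e"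
      using n[of i] by (simp add: simps r_def)
  qed
qed

section \<open>Identity theorems along complex lines\<close>

lemma scaleR_eq_of_real: "x *\<^sub>R (d :: complex ^ 'n) = (of_real x :: complex) *s d"
  by (auto simp: Finite_Cartesian_Product.vec_eq_iff complex_eq_iff)

text \<open>The restriction of \<open>f\<close> to a complex line is holomorphic in one variable on the convex set of
  parameters with values in \<open>W\<close>; it vanishes as soon as it vanishes at small real parameters,
  since these accumulate at 0. Real parameters suffice, so the lemma applies both to zero sets
  with interior points and to the totally real directions of \<open>Z_alpha\<close>.\<close>
lemma mv_holomorphic_zero_along_line:
  fixes f :: "complex ^ 'n::finite \<Rightarrow> complex"
  assumes hol: "mv_holomorphic_on f S" and W: "open W" "convex W" "W \<subseteq> S" "w \<in> W" "w + c *s d \<in> W"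
    and e: "e > 0" and zero: "\<And>x. \<bar>x\<bar> < e \<Longrightarrow> f (w + of_real x *s d) = 0"
  shows "f (w + c *s d) = 0"
proof -
  define l where "l = (\<lambda>\<mu>. w + \<mu> *s d)"
  have lin: "bounded_linear (\<lambda>\<mu>. \<mu> *s d)"
    by (intro linear_conv_bounded_linear[THEN iffD1] linearI)
      (simp_all add: Finite_Cartesian_Product.vec_eq_iff algebra_simps)
  have dl: "(l has_derivative (\<lambda>\<mu>. \<mu> *s d)) (at x)" for x
    unfolding l_def using bounded_linear_imp_has_derivative[OF lin, of "at x"]
    by (auto intro!: derivative_eq_intros)
  have cont: "continuous_on UNIV l"
    using dl by (intro continuous_at_imp_continuous_on ballI has_derivative_continuous)
  define P where "P = l -` W"
  have P: "open P"
    unfolding P_def using W(1) cont by (simp add: continuous_on_open_vimage[of UNIV, simplified])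
  have l_affine: "l ((1 - t) *\<^sub>R x + t *\<^sub>R y) = (1 - t) *\<^sub>R l x + t *\<^sub>R l y" for x y t
    by (simp add: l_def Finite_Cartesian_Product.vec_eq_iff algebra_simps)
  have "convex P"
    unfolding convex_alt P_def using W(2) by (auto simp: l_affine convex_alt)
  have "(\<lambda>x. f (l x)) holomorphic_on P"
    unfolding holomorphic_on_def field_differentiable_def
  proof
    fix x assume x: "x \<in> P"
    then have "l x \<in> S" using W(3) by (auto simp: P_def)
    then obtain D where D: "Vector_Spaces.linear (*s) (*) D" "(f has_derivative D) (at (l x))"
      using hol by (auto simp: mv_holomorphic_on_def)
    have "((\<lambda>x. f (l x)) has_derivative (\<lambda>\<mu>. D (\<mu> *s d))) (at x)"
      using has_derivative_compose[OF dl D(2)] by simp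
    moreover have "D (\<mu> *s d) = D d * \<mu>" for \<mu>
    proof -
      have "D (\<mu> *s d) = \<mu> * D d"
        using D(1) unfolding Vector_Spaces.linear_def by (blast intro: module_hom.scale)
      then show ?thesis by (simp only: mult.commute)
    qed
    ultimately have "((\<lambda>x. f (l x)) has_field_derivative D d) (at x)"
      by (simp add: has_field_derivative_def)
    then show "\<exists>f'. ((\<lambda>x. f (l x)) has_field_derivative f') (at x within P)"
      using has_field_derivative_at_within by blast
  qed
  moreover have "0 islimpt (P \<inter> of_real ` {-e<..<e})"
  proof -
    have "0 \<in> P" using W(4) by (simp add: P_def l_def)
    then obtain e0 where e0: "e0 > 0" "ball 0 e0 \<subseteq> P" using P open_contains_ball by blast
    show ?thesis
      unfolding islimpt_approachable
    proof (intro allI impI)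
      fix e' :: real assume "e' > 0"
      define r where "r = min e (min e0 e') / 2"
      have r: "0 < r" "r < e" "r < e0" "r < e'"
        using e e0(1) \<open>e' > 0\<close> by (auto simp: r_def min_def)
      then have "of_real r \<in> P"
        using e0(2) by (auto simp: subset_iff dist_norm)
      then show "\<exists>x'\<in>P \<inter> of_real ` {-e<..<e}. x' \<noteq> 0 \<and> dist x' 0 < e'"
        using r by (intro bexI[of _ "of_real r"]) auto
    qed
  qed
  moreover have "f (l z) = 0" if "z \<in> P \<inter> of_real ` {-e<..<e}" for z
    using that zero by (auto simp: l_def abs_less_iff)
  moreover have "c \<in> P" "0 \<in> P" using W(4,5) by (auto simp: P_def l_def)
  ultimately show ?thesis
    using analytic_continuation[of "\<lambda>x. f (l x)" P "P \<inter> of_real ` {-e<..<e}" 0 c] P \<open>convex P\<close>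
    by (auto simp: l_def convex_connected)
qed

lemma mv_holomorphic_identity:
  fixes f :: "complex ^ 'n::finite \<Rightarrow> complex"
  assumes hol: "mv_holomorphic_on f S" and W: "open W" "convex W" "W \<subseteq> S"
    and N: "open N" "q \<in> N" "q \<in> W" "\<And>z. z \<in> N \<Longrightarrow> f z = 0" and z: "z \<in> W"
  shows "f z = 0"
proof -
  obtain r where r: "r > 0" "ball q r \<subseteq> N"
    using N(1,2) open_contains_ball by blast
  define e where "e = r / (norm (z - q) + 1)"
  have "f (q + 1 *s (z - q)) = 0"
  proof (rule mv_holomorphic_zero_along_line[OF hol W N(3)])
    show "e > 0" using r(1) by (simp add: e_def add_nonneg_pos)
    fix x :: real assume x: "\<bar>x\<bar> < e"
    have "norm (of_real x *s (z - q)) = \<bar>x\<bar> * norm (z - q)"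
      by (metis norm_scaleR scaleR_eq_of_real)
    also have "\<dots> \<le> \<bar>x\<bar> * (norm (z - q) + 1)"
      by (simp add: algebra_simps)
    also have "\<dots> < r"
      using x by (simp add: e_def pos_less_divide_eq add_nonneg_pos)
    finally have "q + of_real x *s (z - q) \<in> ball q r"
      by (simp add: dist_norm del: vector_ssub_ldistrib)
    then show "f (q + of_real x *s (z - q)) = 0"
      using r(2) N(4) by blast
  qed (use z in auto)
  then show ?thesis by simp
qed

text \<open>Moving the imaginary parts of the first \<open>s\<close> coordinates of \<open>z\<close> to \<open>\<alpha>\<close> gives a point \<open>w\<close> of
  \<open>Z_alpha\<close> that is no farther from \<open>z0\<close>. The displacement is $i$ times a vector \<open>d\<close> with real
  entries; the real line through \<open>w\<close> in direction \<open>d\<close> stays in \<open>Z_alpha\<close>, and \<open>z\<close> is the point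
  with parameter $i$ on its complexification.\<close>
lemma mv_holomorphic_zero_on_Z_alpha:
  fixes f :: "complex ^ ('s::finite + 't::finite) \<Rightarrow> complex"
  assumes hol: "mv_holomorphic_on f S" and z0: "z0 \<in> Z_alpha \<alpha>" and \<alpha>: "\<And>i. \<alpha> i > 0"
    and r: "r > 0" "ball z0 r \<subseteq> S"
    and zero: "\<And>z. z \<in> Z_alpha \<alpha> \<inter> ball z0 r \<Longrightarrow> f z = 0" and z: "z \<in> ball z0 r"
  shows "f z = 0"
proof -
  define d :: "complex ^ ('s + 't)" where
    "d = (\<chi> k. case k of Inl i \<Rightarrow> of_real (Im (z $ Inl i) - \<alpha> i) | Inr j \<Rightarrow> 0)"
  define w where "w = z - \<i> *s d"
  have w: "w + of_real x *s d \<in> Z_alpha \<alpha>" for x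
    using \<alpha> by (auto simp: Z_alpha_def HC_def w_def d_def)
  have "norm (w - z0) \<le> norm (z - z0)"
    unfolding norm_vec_def
  proof (rule L2_set_mono)
    fix k
    show "norm ((w - z0) $ k) \<le> norm ((z - z0) $ k)"
    proof (cases k)
      case (Inl i)
      then show ?thesis
        using z0 by (auto simp: w_def d_def Z_alpha_def cmod_def)
    qed (simp add: w_def d_def)
  qed auto
  then have wb: "w \<in> ball z0 r"
    using z by (simp add: dist_norm norm_minus_commute)
  then obtain r' where r': "r' > 0" "ball w r' \<subseteq> ball z0 r"
    using open_contains_ball open_ball by blast
  define e where "e = r' / (norm d + 1)"
  have "f (w + \<i> *s d) = 0"
  proof (rule mv_holomorphic_zero_along_line[OF hol open_ball convex_ball r(2) wb])
    show "e > 0" using r'(1) by (simp add: e_def add_nonneg_pos)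
    fix x :: real assume x: "\<bar>x\<bar> < e"
    have "norm (of_real x *s d) = \<bar>x\<bar> * norm d"
      by (metis norm_scaleR scaleR_eq_of_real)
    also have "\<dots> \<le> \<bar>x\<bar> * (norm d + 1)"
      by (simp add: algebra_simps)
    also have "\<dots> < r'"
      using x by (simp add: e_def pos_less_divide_eq add_nonneg_pos)
    finally have "w + of_real x *s d \<in> ball w r'"
      by (simp add: dist_norm)
    then show "f (w + of_real x *s d) = 0"
      using r'(2) w zero by blast
  qed (use z in \<open>simp add: w_def\<close>)
  then show ?thesis by (simp add: w_def)
qed

section \<open>The closure of a leaf\<close>

text \<open>Conjugating a translation by $R_u$ gives the translation by $ua$, so precomposition with
  $T_a$ maps the transformation group to itself; this uses that the integers are closed under
  addition and under multiplication by units.\<close>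
lemma OT_proj_translate:
  assumes \<sigma>: "embedding_numbering \<sigma>" and U: "U \<subseteq> int_ring" and a: "a \<in> int_ring"
  shows "OT_proj \<sigma> U (OT_T \<sigma> a z) = OT_proj \<sigma> U z"
proof -
  note hom = complex_embeddings_simps[OF embedding_numbering_complex[OF \<sigma>]]
  have sub: "OT_proj \<sigma> U (OT_T \<sigma> a z) \<subseteq> OT_proj \<sigma> U z" if a: "a \<in> int_ring" for a z
  proof
    fix y assume "y \<in> OT_proj \<sigma> U (OT_T \<sigma> a z)"
    then obtain b u where bu: "b \<in> int_ring" "u \<in> U" "y = OT_T \<sigma> b (OT_R \<sigma> u (OT_T \<sigma> a z))"
      by (auto simp: OT_proj_def OT_group_def)
    have "y = (OT_T \<sigma> (b + u * a) \<circ> OT_R \<sigma> u) z"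
      by (simp add: bu(3) OT_T_def OT_R_def hom Finite_Cartesian_Product.vec_eq_iff algebra_simps)
    moreover have "b + u * a \<in> int_ring"
      using bu a U by (auto intro: int_ring_closed)
    ultimately show "y \<in> OT_proj \<sigma> U z"
      using bu(2) unfolding OT_proj_def OT_group_def by blast
  qed
  have "OT_T \<sigma> (- a) (OT_T \<sigma> a z) = z"
    by (simp add: OT_T_def hom Finite_Cartesian_Product.vec_eq_iff)
  then show ?thesis
    using sub[OF a, of z] sub[OF int_ring_closed(3)[OF a], of "OT_T \<sigma> a z"] by auto
qed

text \<open>The straight segment from \<open>z0\<close> to \<open>w\<close> has a constant velocity that lies in the
  distribution, and its projection is a tangent curve with a global lift.\<close>
lemma OT_leaf_contains_complex_directions:
  fixes \<sigma> :: "'s::finite + 't::finite \<Rightarrow> 'k::field_char_0 \<Rightarrow> complex"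
  assumes z0: "z0 \<in> HC" and w: "\<And>i. w $ Inl i = z0 $ Inl i"
  shows "OT_proj \<sigma> U w \<in> OT_leaf \<sigma> U (OT_proj \<sigma> U z0)"
proof -
  define g where "g = (\<lambda>x::real. z0 + x *\<^sub>R (w - z0))"
  have gHC: "g x \<in> HC" for x
    using z0 w by (auto simp: HC_def g_def)
  define d where "d = w - z0"
  have d: "d $ Inl i = 0" for i
    by (simp add: d_def w)
  have "d = (\<Sum>j\<in>UNIV. d $ Inr j *s axis (Inr j) 1)"
  proof (subst Finite_Cartesian_Product.vec_eq_iff, intro allI)
    fix k :: "'s + 't"
    show "d $ k = (\<Sum>j\<in>UNIV. d $ Inr j *s axis (Inr j) 1) $ k"
    proof (cases k)
      case (Inl i)
      then show ?thesis by (simp add: d axis_def)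
    next
      case (Inr j)
      have "(\<Sum>j'\<in>UNIV. d $ Inr j' * (axis (Inr j') 1 :: complex ^ ('s + 't)) $ Inr j)
          = (\<Sum>j'\<in>UNIV. if j' = j then d $ Inr j' else 0)"
        by (intro sum.cong) (auto simp: axis_def)
      then show ?thesis using Inr by simp
    qed
  qed
  also have "\<dots> \<in> OT_distribution"
    unfolding OT_distribution_def by (intro vec.span_sum vec.span_scale vec.span_base) blast
  finally have D: "w - z0 \<in> OT_distribution"
    by (simp only: d_def)
  have deriv: "(g has_vector_derivative (w - z0)) (at x within X)" for x X
    unfolding g_def by (auto intro!: derivative_eq_intros)
  have "OT_tangent_curve \<sigma> U (\<lambda>x. OT_proj \<sigma> U (g x))"
    unfolding OT_tangent_curve_def
    using gHC D deriv by (intro ballI exI[of _ 1] conjI zero_less_one exI[of _ g]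
      exI[of _ "\<lambda>_. w - z0"]) auto
  moreover have "g 0 = z0" "g 1 = w"
    by (simp_all add: g_def)
  ultimately show ?thesis
    unfolding OT_leaf_def by (intro CollectI exI[of _ "\<lambda>x. OT_proj \<sigma> U (g x)"]) auto
qed

lemma open_HC: "open (HC :: (complex ^ ('s::finite + 't::finite)) set)"
proof -
  have "HC = (\<Inter>i. {z :: complex ^ ('s + 't). Im (z $ Inl i) > 0})"
    by (auto simp: HC_def)
  also have "open \<dots>"
  proof (rule open_INT)
    show "\<forall>i\<in>UNIV. open {z :: complex ^ ('s + 't). Im (z $ Inl i) > 0}"
      by (intro ballI open_Collect_less continuous_on_const continuous_on_Im
        continuous_on_component continuous_on_id)
  qed simp
  finally show ?thesis .
qed

lemma convex_HC: "convex (HC :: (complex ^ ('s::finite + 't::finite)) set)"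
proof -
  have "HC = (\<Inter>i. (\<lambda>z :: complex ^ ('s + 't). Im (z $ Inl i)) -` {0<..})"
    by (auto simp: HC_def)
  also have "convex \<dots>"
  proof (rule convex_INT)
    fix i
    have "linear (\<lambda>z :: complex ^ ('s + 't). Im (z $ Inl i))"
      by (rule linearI) auto
    then show "convex ((\<lambda>z :: complex ^ ('s + 't). Im (z $ Inl i)) -` {0<..})"
      by (rule convex_linear_vimage) (rule convex_real_interval)
  qed
  finally show ?thesis .
qed

lemma open_OT_preimage:
  assumes "openin (OT_topology \<sigma> U) V"
  shows "open (OT_preimage \<sigma> U V)"
  using assms open_HC by (auto simp: openin_OT_topology openin_open)

lemma topspace_OT_topology: "topspace (OT_topology \<sigma> U) = OT_manifold \<sigma> U"
  using quotient_map_OT_proj[of \<sigma> U] by (auto simp: quotient_map_def OT_manifold_def)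

text \<open>Near \<open>z\<close> there is a point \<open>w\<close> that agrees with \<open>z\<close> in the last \<open>t\<close> coordinates and with a
  translate of \<open>z0\<close> by an integer in the first \<open>s\<close>. Translating it back leads to a point that
  differs from \<open>z0\<close> only in leaf directions.\<close>
lemma Z_alpha_subset_leaf_closure:
  fixes \<sigma> :: "'s::finite + 't::finite \<Rightarrow> 'k::field_char_0 \<Rightarrow> complex"
  assumes \<sigma>: "embedding_numbering \<sigma>" and U: "admissible \<sigma> U" and z0: "z0 \<in> HC"
  shows "Z_alpha (\<lambda>i. Im (z0 $ Inl i))
    \<subseteq> OT_preimage \<sigma> U (OT_topology \<sigma> U closure_of OT_leaf \<sigma> U (OT_proj \<sigma> U z0))"
proof
  fix z :: "complex ^ ('s + 't)" assume z: "z \<in> Z_alpha (\<lambda>i. Im (z0 $ Inl i))"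
  then have zHC: "z \<in> HC" and Im_z: "\<And>i. Im (z $ Inl i) = Im (z0 $ Inl i)"
    by (auto simp: Z_alpha_def)
  have "\<exists>q\<in>OT_leaf \<sigma> U (OT_proj \<sigma> U z0). q \<in> V"
    if V: "OT_proj \<sigma> U z \<in> V" "openin (OT_topology \<sigma> U) V" for V
  proof -
    have "z \<in> OT_preimage \<sigma> U V"
      using V(1) zHC by (simp add: OT_preimage_def)
    then obtain e where e: "e > 0" "ball z e \<subseteq> OT_preimage \<sigma> U V"
      using open_OT_preimage[OF V(2)] open_contains_ball by blast
    \<comment> \<open>The norm is at most the sum of the moduli of the \<open>m\<close> coordinates.\<close>
    define m where "m = real (CARD('s + 't))"
    have m: "m > 0" unfolding m_def using zero_less_card_finite of_nat_0_less_iff by blast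
    obtain a where a: "a \<in> int_ring"
      "\<And>i. \<bar>(Re (z $ Inl i) - Re (z0 $ Inl i)) - real_embedding_vec \<sigma> a $ i\<bar> < e / m"
      using int_ring_dense_in_real_embeddings[OF \<sigma> U, of "e / m"
          "\<lambda>i. Re (z $ Inl i) - Re (z0 $ Inl i)"] e(1) m by (metis divide_pos_pos)
    define w :: "complex ^ ('s + 't)" where
      "w = (\<chi> k. case k of Inl i \<Rightarrow> z0 $ Inl i + \<sigma> (Inl i) a | Inr j \<Rightarrow> z $ Inr j)"
    have "norm (z - w) \<le> (\<Sum>k\<in>UNIV. norm ((z - w) $ k))"
      unfolding norm_vec_def by (rule L2_set_le_sum) simp
    also have "\<dots> < (\<Sum>k\<in>(UNIV :: ('s + 't) set). e / m)"
    proof (rule sum_strict_mono)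
      fix k :: "'s + 't"
      show "norm ((z - w) $ k) < e / m"
      proof (cases k)
        case (Inl i)
        have "(z - w) $ Inl i
            = of_real ((Re (z $ Inl i) - Re (z0 $ Inl i)) - real_embedding_vec \<sigma> a $ i)"
          using embedding_numbering_real[OF \<sigma>, of i a] Im_z[of i]
          by (simp add: w_def real_embedding_vec_def complex_eq_iff)
        then show ?thesis
          using a(2)[of i] Inl by (simp only: norm_of_real)
      qed (use e m in \<open>simp add: w_def\<close>)
    qed auto
    also have "\<dots> = e"
      using m by (simp add: m_def)
    finally have "w \<in> OT_preimage \<sigma> U V"
      using e(2) by (auto simp: dist_norm)
    then have "OT_proj \<sigma> U w \<in> V"
      by (simp add: OT_preimage_def)
    moreover have "OT_proj \<sigma> U (OT_T \<sigma> (- a) w) = OT_proj \<sigma> U w"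
      using OT_proj_translate[OF \<sigma> admissible_subset_int_ring[OF U]] a(1) int_ring_closed(3) by blast
    moreover have "OT_proj \<sigma> U (OT_T \<sigma> (- a) w) \<in> OT_leaf \<sigma> U (OT_proj \<sigma> U z0)"
      using complex_embeddings_simps(4)[OF embedding_numbering_complex[OF \<sigma>]]
      by (intro OT_leaf_contains_complex_directions[OF z0]) (simp add: OT_T_def w_def)
    ultimately show ?thesis by metis
  qed
  then show "z \<in> OT_preimage \<sigma> U (OT_topology \<sigma> U closure_of OT_leaf \<sigma> U (OT_proj \<sigma> U z0))"
    using zHC by (auto simp: OT_preimage_def in_closure_of topspace_OT_topology OT_manifold_def)
qed

section \<open>Analytic subvarieties containing the closure of a leaf\<close>

lemma OT_analytic_subvariety_local_equations:
  assumes A: "OT_analytic_subvariety \<sigma> U A" and z: "z \<in> HC"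
  obtains r F where "r > 0" "\<forall>f\<in>F. mv_holomorphic_on f (ball z r)"
    "\<forall>w\<in>ball z r. w \<in> OT_preimage \<sigma> U A \<longleftrightarrow> (\<forall>f\<in>F. f w = 0)"
proof -
  have zM: "OT_proj \<sigma> U z \<in> OT_manifold \<sigma> U"
    using z by (simp add: OT_manifold_def)
  obtain V F where VF: "OT_proj \<sigma> U z \<in> V" "openin (OT_topology \<sigma> U) V"
    "\<forall>f\<in>F. OT_holomorphic_on \<sigma> U f V" "A \<inter> V = {q \<in> V. \<forall>f\<in>F. f q = 0}"
    using bspec[OF conjunct2[OF A[unfolded OT_analytic_subvariety_def]] zM]
    by (elim exE conjE) (rule that)
  have "z \<in> OT_preimage \<sigma> U V"
    using VF(1) z by (simp add: OT_preimage_def)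
  then obtain r where r: "r > 0" "ball z r \<subseteq> OT_preimage \<sigma> U V"
    using open_OT_preimage[OF VF(2)] open_contains_ball by blast
  show ?thesis
  proof (rule that[of r "(\<lambda>f. f \<circ> OT_proj \<sigma> U) ` F"])
    show "\<forall>f\<in>(\<lambda>f. f \<circ> OT_proj \<sigma> U) ` F. mv_holomorphic_on f (ball z r)"
      using VF(3) r(2) by (auto simp: OT_holomorphic_on_def mv_holomorphic_on_def)
    show "\<forall>w\<in>ball z r. w \<in> OT_preimage \<sigma> U A \<longleftrightarrow> (\<forall>f\<in>(\<lambda>f. f \<circ> OT_proj \<sigma> U) ` F. f w = 0)"
      using r(2) VF(4) by (auto simp: OT_preimage_def)
  qed (rule r(1))
qed

text \<open>The interior \<open>I\<close> of the preimage of \<open>A\<close> contains a point of \<open>Z_alpha\<close>, because the local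
  equations vanish identically near it. Near a limit point of \<open>I\<close> the local equations vanish on a
  nonempty open subset of a ball, hence on the ball; so \<open>I\<close> is closed in the connected space
  \<open>HC\<close> as well.\<close>
lemma OT_analytic_subvariety_containing_Z_alpha:
  fixes \<sigma> :: "'s::finite + 't::finite \<Rightarrow> 'k::field_char_0 \<Rightarrow> complex"
  assumes A: "OT_analytic_subvariety \<sigma> U A" and \<alpha>: "\<And>i. \<alpha> i > 0"
    and sub: "Z_alpha \<alpha> \<subseteq> OT_preimage \<sigma> U A"
  shows "A = OT_manifold \<sigma> U"
proof -
  define I where "I = interior (OT_preimage \<sigma> U A)"
  have IHC: "I \<subseteq> HC"
    using interior_subset by (force simp: I_def OT_preimage_def)
  have nonempty: "I \<noteq> {}"
  proof -
    define z0 :: "complex ^ ('s + 't)" where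
      "z0 = (\<chi> k. case k of Inl i \<Rightarrow> \<i> * of_real (\<alpha> i) | Inr j \<Rightarrow> 0)"
    have z0: "z0 \<in> Z_alpha \<alpha>"
      using \<alpha> by (auto simp: Z_alpha_def HC_def z0_def)
    then have z0HC: "z0 \<in> HC" by (simp add: Z_alpha_def)
    obtain r F where rF: "r > 0" "\<forall>f\<in>F. mv_holomorphic_on f (ball z0 r)"
      "\<forall>w\<in>ball z0 r. w \<in> OT_preimage \<sigma> U A \<longleftrightarrow> (\<forall>f\<in>F. f w = 0)"
      using OT_analytic_subvariety_local_equations[OF A z0HC] .
    have "f w = 0" if "f \<in> F" "w \<in> ball z0 r" for f w
    proof (rule mv_holomorphic_zero_on_Z_alpha[OF rF(2)[rule_format, OF that(1)] z0 \<alpha> rF(1) order_refl _ that(2)])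
      fix y assume "y \<in> Z_alpha \<alpha> \<inter> ball z0 r"
      then show "f y = 0"
        using sub rF(3) that(1) by blast
    qed
    then have "ball z0 r \<subseteq> OT_preimage \<sigma> U A"
      using rF(3) by blast
    then have "z0 \<in> I"
      unfolding I_def using rF(1) mem_interior by blast
    then show ?thesis by blast
  qed
  have closed: "z \<in> I" if z: "z \<in> HC" "z \<in> closure I" for z
  proof -
    obtain r F where rF: "r > 0" "\<forall>f\<in>F. mv_holomorphic_on f (ball z r)"
      "\<forall>w\<in>ball z r. w \<in> OT_preimage \<sigma> U A \<longleftrightarrow> (\<forall>f\<in>F. f w = 0)"
      using OT_analytic_subvariety_local_equations[OF A z(1)] .
    obtain q where q: "q \<in> I" "q \<in> ball z r"
      using z(2) rF(1) by (auto simp: closure_approachable dist_commute)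
    have zero: "f w = 0" if "f \<in> F" "w \<in> I \<inter> ball z r" for f w
      using that rF(3) interior_subset[of "OT_preimage \<sigma> U A"] unfolding I_def by blast
    have "f w = 0" if "f \<in> F" "w \<in> ball z r" for f w
    proof (rule mv_holomorphic_identity[OF rF(2)[rule_format, OF that(1)] open_ball convex_ball order_refl
          _ _ q(2) zero[OF that(1)] that(2)])
      show "open (I \<inter> ball z r)" "q \<in> I \<inter> ball z r"
        using q by (auto simp: I_def)
    qed
    then have "ball z r \<subseteq> OT_preimage \<sigma> U A"
      using rF(3) by blast
    then show ?thesis
      unfolding I_def using rF(1) mem_interior by blast
  qed
  have "openin (top_of_set HC) I"
    using IHC by (simp add: I_def open_subset)
  moreover have "I = HC \<inter> closure I"
    using IHC closure_subset closed by blast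
  then have "closedin (top_of_set HC) I"
    using closedin_closed_Int[OF closed_closure, of HC I] by simp
  ultimately have "I = HC"
    using nonempty convex_connected[OF convex_HC] unfolding connected_clopen by blast
  then have "HC \<subseteq> OT_preimage \<sigma> U A"
    using interior_subset I_def by metis
  moreover have "A \<subseteq> OT_manifold \<sigma> U"
    using A closedin_subset topspace_OT_topology by (fastforce simp: OT_analytic_subvariety_def)
  ultimately show ?thesis
    by (auto simp: OT_manifold_def OT_preimage_def)
qed

section \<open>Leaf closures and the subvarieties containing them\<close>

theorem proposition3p2:
  fixes \<sigma> :: "'s::finite + 't::finite \<Rightarrow> 'k::field_char_0 \<Rightarrow> complex"
    and U :: "'k set"
    and L Z :: "(complex ^ ('s + 't)) set set"
  assumes "number_field TYPE('k)"
    and "field_degree TYPE('k) = CARD('s) + 2 * CARD('t)"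
    and "embedding_numbering \<sigma>"
    and "admissible \<sigma> U"
    and "L \<in> OT_leaves \<sigma> U"
    and "Z = OT_topology \<sigma> U closure_of L"
  shows "(\<exists>\<alpha> :: 's \<Rightarrow> real. (\<forall>i. \<alpha> i > 0) \<and> Z_alpha \<alpha> \<subseteq> OT_preimage \<sigma> U Z) \<and>
         (\<forall>A. OT_analytic_subvariety \<sigma> U A \<and> Z \<subseteq> A \<longrightarrow> A = OT_manifold \<sigma> U)"
proof -
  obtain z0 where z0: "z0 \<in> HC" "L = OT_leaf \<sigma> U (OT_proj \<sigma> U z0)"
    using assms(5) by (auto simp: OT_leaves_def OT_manifold_def)
  define \<alpha> where "\<alpha> = (\<lambda>i. Im (z0 $ Inl i))"
  have \<alpha>: "\<And>i. \<alpha> i > 0"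
    using z0(1) by (simp add: HC_def \<alpha>_def)
  have Z: "Z_alpha \<alpha> \<subseteq> OT_preimage \<sigma> U Z"
    unfolding assms(6) z0(2) \<alpha>_def
    by (rule Z_alpha_subset_leaf_closure[OF assms(3,4) z0(1)])
  have "A = OT_manifold \<sigma> U" if "OT_analytic_subvariety \<sigma> U A" "Z \<subseteq> A" for A
    using that Z by (intro OT_analytic_subvariety_containing_Z_alpha[OF that(1) \<alpha>])
      (auto simp: OT_preimage_def)
  then show ?thesis
    using \<alpha> Z by blast
qed

end
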